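(* Let $A\subseteq\mathbb{Z}$ with $\mathrm{BD}(A)=\alpha>0$. Then there exists a set of natural numbers $E\subseteq\mathbb{N}$ such that: (1) $\sigma(E)\ge\alpha$; (2) $E\lhd_d A$, and hence $\Delta(E)\subseteq\Delta_0(A)$ and $\Delta_\epsilon(E)\subseteq\Delta_\epsilon(A)$ for all real $\epsilon\ge 0$.
   Context: $\mathbb{N}$ is the set of positive integers. The upper Banach density of $A\subseteq\mathbb{Z}$ is $\mathrm{BD}(A)=\lim_{n\to\infty}\max_{x\in\mathbb{Z}}\frac{|A\cap[x+1,x+n]|}{n}=\inf_{n\in\mathbb{N}}\max_{x\in\mathbb{Z}}\frac{|A\cap[x+1,x+n]|}{n}$. The Schnirelmann density of $E\subseteq\mathbb{N}$ is $\sigma(E)=\inf_{n\in\mathbb{N}}|E\cap[1,n]|/n$. $X\lhd_d Y$ ("$X$ is densely embeddable in $Y$", for $X,Y\subseteq\mathbb{Z}$) means: for every finite $F\subseteq X$, the set $\bigcap_{x\in F}(Y-x)=\{t\in\mathbb{Z}\mid t+F\subseteq Y\}$ has positive upper Banach density. $\Delta(A)=A-A=\{a-a'\mid a,a'\in A\}$, and for real $\epsilon\ge0$, $\Delta_\epsilon(A)=\{t\in\mathbb{Z}\mid \mathrm{BD}(A\cap(A-t))>\epsilon\}$, where $A-t=\{a-t\mid a\in A\}$. *)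

theory Defs
  imports Complex_Main
begin

text \<open>The positive integers are taken inside \<^typ>\<open>int\<close>, as \<open>{1..}\<close>, so that
  subsets of \<open>\<nat>\<close> and subsets of \<open>\<int>\<close> have the same type. The maximum below ranges over a
  finite set of values in \<open>{0..n}\<close>, see \<open>finite_range_card_window\<close>.\<close>

definition max_count :: "int set \<Rightarrow> nat \<Rightarrow> nat" where
  "max_count A n = (MAX x::int. card (A \<inter> {x + 1..x + int n}))"

definition BD :: "int set \<Rightarrow> real" where
  "BD A = lim (\<lambda>n. real (max_count A n) / real n)"

definition schnirelmann_density :: "int set \<Rightarrow> real" where
  "schnirelmann_density E = (INF n\<in>{1::nat..}. real (card (E \<inter> {1..int n})) / real n)"

definition shift :: "int set \<Rightarrow> int \<Rightarrow> int set" where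
  "shift A t = (\<lambda>a. a - t) ` A"

text \<open>For \<open>F = {}\<close> the intersection is all of \<open>\<int>\<close>.\<close>

definition densely_embeddable :: "int set \<Rightarrow> int set \<Rightarrow> bool"  (infix "\<lhd>\<^sub>d" 50) where
  "X \<lhd>\<^sub>d Y \<longleftrightarrow> (\<forall>F. finite F \<and> F \<subseteq> X \<longrightarrow> BD (\<Inter>x\<in>F. shift Y x) > 0)"

definition Delta :: "int set \<Rightarrow> int set" where
  "Delta A = {a - a' | a a'. a \<in> A \<and> a' \<in> A}"

definition Delta_eps :: "real \<Rightarrow> int set \<Rightarrow> int set" where
  "Delta_eps \<epsilon> A = {t. BD (A \<inter> shift A t) > \<epsilon>}"

text \<open>The limit defining \<^const>\<open>BD\<close> exists, and it is the infimum (Fekete's lemma).\<close>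

lemma card_window_le: "card (A \<inter> {x + 1..x + int n}) \<le> n"
proof -
  have "card (A \<inter> {x + 1..x + int n}) \<le> card {x + 1..x + int n}"
    by (intro card_mono) auto
  then show ?thesis by simp
qed

lemma finite_range_card_window: "finite (range (\<lambda>x::int. card (A \<inter> {x + 1..x + int n})))"
  by (rule finite_subset[of _ "{..n}"]) (auto intro: card_window_le)

lemma card_window_le_max_count: "card (A \<inter> {x + 1..x + int n}) \<le> max_count A n"
  unfolding max_count_def by (intro Max_ge finite_range_card_window) auto

lemma max_count_le: "max_count A n \<le> n"
  unfolding max_count_def
  by (subst Max_le_iff) (use finite_range_card_window card_window_le in auto)

lemma max_count_add: "max_count A (m + n) \<le> max_count A m + max_count A n"
proof -
  have "card (A \<inter> {x + 1..x + int (m + n)}) \<le> max_count A m + max_count A n" for x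
  proof -
    have "A \<inter> {x + 1..x + int (m + n)} =
      (A \<inter> {x + 1..x + int m}) \<union> (A \<inter> {(x + int m) + 1..(x + int m) + int n})"
      by auto
    then have "card (A \<inter> {x + 1..x + int (m + n)}) \<le>
      card (A \<inter> {x + 1..x + int m}) + card (A \<inter> {(x + int m) + 1..(x + int m) + int n})"
      by (metis card_Un_le)
    with card_window_le_max_count[of A x m] card_window_le_max_count[of A "x + int m" n]
    show ?thesis by linarith
  qed
  then show ?thesis
    unfolding max_count_def[of A "m + n"]
    by (subst Max_le_iff) (use finite_range_card_window[of A "m + n"] in auto)
qed

lemma max_count_mult_add: "max_count A (q * k + r) \<le> q * max_count A k + r"
proof (induction q)
  case 0
  then show ?case using max_count_le[of A r] by simp
next
  case (Suc q)
  have "max_count A (Suc q * k + r) \<le> max_count A k + max_count A (q * k + r)"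
    using max_count_add[of A k "q * k + r"] by (simp add: add.assoc)
  with Suc show ?case by simp
qed

lemma BD_LIMSEQ_INF:
  "(\<lambda>n. real (max_count A n) / real n) \<longlonglongrightarrow> (INF n\<in>{1::nat..}. real (max_count A n) / real n)"
    (is "?f \<longlonglongrightarrow> ?L")
proof (rule LIMSEQ_I)
  fix e :: real assume e: "e > 0"
  have bdd: "bdd_below (?f ` {1..})"
    by (intro bdd_belowI[of _ 0]) auto
  have lower: "?L \<le> ?f n" if "n \<ge> 1" for n
    using that by (intro cINF_lower bdd) auto
  have "\<exists>k\<in>{1..}. ?f k < ?L + e / 2"
    using e by (subst cINF_less_iff[symmetric]) (use bdd in auto)
  then obtain k where k: "k \<ge> 1" "?f k < ?L + e / 2" by auto
  obtain N :: nat where N: "real N > 2 * real k / e" using reals_Archimedean2 by blast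
  show "\<exists>no. \<forall>n\<ge>no. norm (?f n - ?L) < e"
  proof (intro exI[of _ "max 1 N"] allI impI)
    fix n assume n: "n \<ge> max 1 N"
    then have n1: "n \<ge> 1" and "real n \<ge> real N" by auto
    with N have "2 * real k / e < real n" by linarith
    then have kn: "real k / real n < e / 2"
      using e n1 by (simp add: field_simps)
    have "max_count A n \<le> (n div k) * max_count A k + n mod k"
      using max_count_mult_add[of A "n div k" k "n mod k"] by simp
    also have "\<dots> \<le> (n div k) * max_count A k + k"
      using k(1) by (simp add: less_imp_le)
    finally have "real (max_count A n) \<le> real (n div k) * real (max_count A k) + real k"
      by (metis of_nat_add of_nat_le_iff of_nat_mult)
    also have "\<dots> \<le> (real n / real k) * real (max_count A k) + real k"
      by (intro add_right_mono mult_right_mono) (auto intro: of_nat_div_le_of_nat)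
    finally have "?f n \<le> ?f k + real k / real n"
      using n1 by (simp add: field_simps)
    with kn k(2) have "?f n < ?L + e" by linarith
    with lower[OF n1] show "norm (?f n - ?L) < e" by simp
  qed
qed

lemma BD_eq_INF: "BD A = (INF n\<in>{1::nat..}. real (max_count A n) / real n)"
  unfolding BD_def by (rule limI[OF BD_LIMSEQ_INF])

end

theory Submission
  imports Defs
begin

text \<open>Why such a set \<open>E\<close> exists.

  Fix \<open>c\<close> with \<open>0 \<le> c < \<alpha>\<close>. If only a null set of positions \<open>t\<close> had the
  property that \<open>A - t\<close> has relative density at least \<open>c\<close> in each of the intervals
  \<open>{1..m}\<close> with \<open>m \<le> N\<close>, then a long interval could be
  tiled, up to these positions, by blocks of length at most \<open>N\<close> in which \<open>A\<close> is sparser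
  than \<open>c\<close>, and \<open>BD A\<close> would be at most \<open>c\<close>. Hence the positions with this property form a set
  of positive upper Banach density (\<open>BD_le_dense_starts\<close>). Letting \<open>N\<close> grow and \<open>c\<close> tend to
  \<open>\<alpha>\<close> gives a decreasing sequence \<open>T\<close> of sets of positive density.

  Positive density is partition regular, so, deciding \<open>1 \<in> E\<close>, \<open>2 \<in> E\<close>, and so on one after
  another, one can follow a branch of the binary tree along which, for all \<open>n\<close> and \<open>N\<close>, the
  positions \<open>t \<in> T N\<close> where \<open>A - t\<close> agrees with \<open>E\<close> on \<open>{1..n}\<close> have positive density
  (\<open>positive_density_branch\<close>). Positivity of the density gives \<open>E \<lhd>\<^sub>d A\<close>. A
  single such position already shows that \<open>E\<close> has at least \<open>c n\<close> elements in \<open>{1..n}\<close>, and \<open>c\<close>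
  is arbitrarily close to \<open>\<alpha>\<close>.

  The inclusions of difference sets follow from dense embeddability alone: it passes finite
  configurations from \<open>E\<close> to translates inside \<open>A\<close>, and \<open>BD\<close> is determined by finite
  configurations (\<open>BD_le_of_embeddable\<close>).\<close>

section \<open>Upper Banach density\<close>

lemma mem_shift_iff [simp]: "x \<in> shift A t \<longleftrightarrow> x + t \<in> A"
  by (force simp: shift_def)

lemma BD_LIMSEQ: "(\<lambda>n. real (max_count A n) / real n) \<longlonglongrightarrow> BD A"
  unfolding BD_eq_INF by (rule BD_LIMSEQ_INF)

lemma max_count_leI:
  assumes "\<And>x. card (A \<inter> {x + 1..x + int n}) \<le> k"
  shows "max_count A n \<le> k"
  unfolding max_count_def
  by (subst Max_le_iff) (use finite_range_card_window assms in auto)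

lemma max_count_attained: "\<exists>x. max_count A n = card (A \<inter> {x + 1..x + int n})"
proof -
  have "max_count A n \<in> range (\<lambda>x::int. card (A \<inter> {x + 1..x + int n}))"
    unfolding max_count_def by (rule Max_in[OF finite_range_card_window]) auto
  then show ?thesis by auto
qed

lemma BD_empty [simp]: "BD {} = 0"
proof -
  have "max_count {} n = 0" for n
    using max_count_leI[of "{}" n 0] by simp
  then have "(\<lambda>n. real (max_count {} n) / real n) = (\<lambda>_. 0)" by simp
  with BD_LIMSEQ[of "{}"] show ?thesis
    by (metis LIMSEQ_unique tendsto_const)
qed

lemma BD_leI:
  assumes "\<And>n. max_count A n \<le> max_count B n"
  shows "BD A \<le> BD B"
  by (rule LIMSEQ_le[OF BD_LIMSEQ BD_LIMSEQ]) (auto intro!: divide_right_mono assms)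

lemma BD_Un_le: "BD (A \<union> B) \<le> BD A + BD B"
proof (rule LIMSEQ_le[OF BD_LIMSEQ tendsto_add[OF BD_LIMSEQ BD_LIMSEQ]], intro exI allI impI)
  fix n :: nat
  have "max_count (A \<union> B) n \<le> max_count A n + max_count B n"
  proof (rule max_count_leI)
    fix x
    show "card ((A \<union> B) \<inter> {x + 1..x + int n}) \<le> max_count A n + max_count B n"
      using card_Un_le[of "A \<inter> {x + 1..x + int n}" "B \<inter> {x + 1..x + int n}"]
        card_window_le_max_count[of A x n] card_window_le_max_count[of B x n]
      by (simp add: Int_Un_distrib2)
  qed
  then have "real (max_count (A \<union> B) n) \<le> real (max_count A n) + real (max_count B n)" by linarith
  then show "real (max_count (A \<union> B) n) / real n
      \<le> real (max_count A n) / real n + real (max_count B n) / real n"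
    by (simp add: add_divide_distrib[symmetric] divide_right_mono)
qed

text \<open>\<open>BD X\<close> depends only on which finite sets have translates inside \<open>X\<close>: a window of
  \<open>X\<close> with maximal count, moved into \<open>Y\<close>, is a window of \<open>Y\<close> with at least that count.\<close>

lemma BD_le_of_embeddable:
  assumes "\<And>F. finite F \<Longrightarrow> F \<subseteq> X \<Longrightarrow> \<exists>t. \<forall>x\<in>F. x + t \<in> Y"
  shows "BD X \<le> BD Y"
proof (rule BD_leI)
  fix n
  obtain x where x: "max_count X n = card (X \<inter> {x + 1..x + int n})"
    using max_count_attained by blast
  obtain t where t: "\<forall>y\<in>X \<inter> {x + 1..x + int n}. y + t \<in> Y"
    using assms[of "X \<inter> {x + 1..x + int n}"] by auto
  have "card (X \<inter> {x + 1..x + int n}) \<le> card (Y \<inter> {(x + t) + 1..(x + t) + int n})"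
    by (rule card_inj_on_le[of "\<lambda>y. y + t"]) (use t in \<open>auto simp: inj_on_def\<close>)
  also have "\<dots> \<le> max_count Y n" by (rule card_window_le_max_count)
  finally show "max_count X n \<le> max_count Y n" using x by simp
qed

lemma BD_mono: "X \<subseteq> Y \<Longrightarrow> BD X \<le> BD Y"
  by (rule BD_le_of_embeddable) (auto intro!: exI[of _ 0])

lemma BD_shift_le: "BD (shift X t) \<le> BD X"
  by (rule BD_le_of_embeddable) (auto intro!: exI[of _ t])

section \<open>Consequences of dense embeddability\<close>

lemma densely_embeddable_imp_embeddable:
  assumes "X \<lhd>\<^sub>d Y" "finite F" "F \<subseteq> X"
  shows "\<exists>t. \<forall>x\<in>F. x + t \<in> Y"
proof -
  have "BD (\<Inter>x\<in>F. shift Y x) > 0"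
    using assms unfolding densely_embeddable_def by blast
  then have "(\<Inter>x\<in>F. shift Y x) \<noteq> {}" by force
  then obtain t where "t \<in> (\<Inter>x\<in>F. shift Y x)" by blast
  then have "\<forall>x\<in>F. x + t \<in> Y" by (auto simp: add.commute[of t])
  then show ?thesis ..
qed

text \<open>For \<open>a, a' \<in> X\<close> the set \<open>(Y - a) \<inter> (Y - a')\<close> is a translate of
  \<open>Y \<inter> (Y - (a - a'))\<close>.\<close>

lemma densely_embeddable_Delta:
  assumes "X \<lhd>\<^sub>d Y"
  shows "Delta X \<subseteq> Delta_eps 0 Y"
proof
  fix d assume "d \<in> Delta X"
  then obtain a a' where d: "d = a - a'" "a \<in> X" "a' \<in> X" by (auto simp: Delta_def)
  have "BD (\<Inter>x\<in>{a, a'}. shift Y x) > 0"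
    using assms[unfolded densely_embeddable_def, rule_format, of "{a, a'}"] d(2,3) by simp
  also have "(\<Inter>x\<in>{a, a'}. shift Y x) = shift (Y \<inter> shift Y d) a'"
    by (auto simp: d algebra_simps)
  also have "BD \<dots> \<le> BD (Y \<inter> shift Y d)" by (rule BD_shift_le)
  finally show "d \<in> Delta_eps 0 Y" by (simp add: Delta_eps_def)
qed

text \<open>A translate of \<open>F \<union> (F + d)\<close> inside \<open>Y\<close> puts a translate of \<open>F\<close> inside
  \<open>Y \<inter> (Y - d)\<close>.\<close>

lemma densely_embeddable_Delta_eps:
  assumes "X \<lhd>\<^sub>d Y"
  shows "Delta_eps \<epsilon> X \<subseteq> Delta_eps \<epsilon> Y"
proof -
  have "BD (X \<inter> shift X d) \<le> BD (Y \<inter> shift Y d)" for d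
  proof (rule BD_le_of_embeddable)
    fix F assume F: "finite F" "F \<subseteq> X \<inter> shift X d"
    then have "finite (F \<union> (\<lambda>x. x + d) ` F)" "F \<union> (\<lambda>x. x + d) ` F \<subseteq> X" by auto
    then obtain t where "\<forall>x\<in>F \<union> (\<lambda>x. x + d) ` F. x + t \<in> Y"
      using densely_embeddable_imp_embeddable[OF assms] by blast
    then have "\<forall>x\<in>F. x + t \<in> Y \<inter> shift Y d" by (auto simp: ball_Un add.assoc add.commute[of t])
    then show "\<exists>t. \<forall>x\<in>F. x + t \<in> Y \<inter> shift Y d" by blast
  qed
  then show ?thesis unfolding Delta_eps_def by (auto intro: less_le_trans)
qed

section \<open>Positions followed by dense initial pieces\<close>

definition dense_starts :: "int set \<Rightarrow> real \<Rightarrow> nat \<Rightarrow> int set" where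
  "dense_starts A c N = {t. \<forall>m\<in>{1..N}. c * real m \<le> real (card (A \<inter> {t + 1..t + int m}))}"

text \<open>The interval is traversed from left to right. At a position in \<open>dense_starts A c N\<close> one
  moves one step and pays 1 for it; at any other position one jumps over a block on which
  \<open>A\<close> is sparser than \<open>c\<close>. The final piece, of length at most \<open>N\<close>, is counted in full. The
  start position of a step is the point before the elements it covers, so the window of
  \<open>dense_starts A c N\<close> is shifted by one.\<close>

lemma card_window_le_dense_starts:
  assumes "c \<ge> 0"
  shows "real (card (A \<inter> {x + 1..x + int L}))
    \<le> c * real L + real (card (dense_starts A c N \<inter> {x..x + int L - 1})) + real N"
proof (induction L arbitrary: x rule: less_induct)
  case (less L)
  let ?T = "dense_starts A c N"
  have split: "real (card (A \<inter> {x + 1..x + int L}))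
      \<le> real (card (A \<inter> {x + 1..x + int m}))
        + real (card (A \<inter> {(x + int m) + 1..(x + int m) + int (L - m)}))" if "m \<le> L" for m
  proof -
    have "A \<inter> {x + 1..x + int L} = (A \<inter> {x + 1..x + int m})
        \<union> (A \<inter> {(x + int m) + 1..(x + int m) + int (L - m)})"
      using that by auto
    then show ?thesis by (metis card_Un_le of_nat_add of_nat_le_iff)
  qed
  consider (short) "L \<le> N" | (dense) "N < L" "x \<in> ?T" | (sparse) "N < L" "x \<notin> ?T"
    by linarith
  then show ?case
  proof cases
    case short
    have "card (A \<inter> {x + 1..x + int L}) \<le> N"
      using card_window_le[of A x L] short by linarith
    moreover have "0 \<le> c * real L" using assms by simp
    ultimately show ?thesis by linarith
  next
    case dense
    let ?W = "?T \<inter> {(x + int 1)..(x + int 1) + int (L - 1) - 1}"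
    have "?T \<inter> {x..x + int L - 1} = insert x ?W"
      using dense by auto
    then have T: "real (card (?T \<inter> {x..x + int L - 1})) = 1 + real (card ?W)" by simp
    have "real (card (A \<inter> {x + 1..x + int 1})) \<le> 1"
      using card_window_le[of A x 1] by simp
    moreover have "c * real (L - 1) \<le> c * real L"
      using assms by (intro mult_left_mono) auto
    ultimately show ?thesis
      using split[of 1] less[of "L - 1" "x + int 1"] dense(1) T by linarith
  next
    case sparse
    then obtain m where m: "1 \<le> m" "m \<le> N"
        "real (card (A \<inter> {x + 1..x + int m})) < c * real m"
      by (auto simp: dense_starts_def not_le)
    have "card (?T \<inter> {x + int m..(x + int m) + int (L - m) - 1})
        \<le> card (?T \<inter> {x..x + int L - 1})"
      by (rule card_mono) (use m sparse in auto)
    moreover have "c * real L = c * real m + c * real (L - m)"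
      using m sparse by (simp add: of_nat_diff algebra_simps)
    ultimately show ?thesis
      using split[of m] less[of "L - m" "x + int m"] m sparse(1) by linarith
  qed
qed

lemma BD_le_dense_starts:
  assumes "c \<ge> 0"
  shows "BD A \<le> c + BD (dense_starts A c N)"
proof -
  let ?T = "dense_starts A c N"
  have "(\<lambda>n. real N / real n) \<longlonglongrightarrow> 0"
    by (rule lim_const_over_n)
  then have lim: "(\<lambda>n. c + real (max_count ?T n) / real n + real N / real n) \<longlonglongrightarrow> c + BD ?T + 0"
    by (intro tendsto_add BD_LIMSEQ tendsto_const)
  have "real (max_count A n) / real n \<le> c + real (max_count ?T n) / real n + real N / real n"
    if n: "n \<ge> 1" for n
  proof -
    obtain x where x: "max_count A n = card (A \<inter> {x + 1..x + int n})"
      using max_count_attained by blast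
    have "card (?T \<inter> {x..x + int n - 1}) \<le> max_count ?T n"
      using card_window_le_max_count[of ?T "x - 1" n] by (simp add: algebra_simps)
    with card_window_le_dense_starts[OF assms, of A x n N] x
    have "real (max_count A n) \<le> c * real n + real (max_count ?T n) + real N"
      by linarith
    with n show ?thesis by (simp add: field_simps)
  qed
  then have "BD A \<le> c + BD ?T + 0"
    by (intro LIMSEQ_le[OF BD_LIMSEQ lim]) auto
  then show ?thesis by simp
qed

section \<open>A branch of positive density\<close>

text \<open>If both halves \<open>D \<inter> B n\<close> and \<open>D - B n\<close> failed, they would fail at a common index because
  \<open>T\<close> is decreasing, and then subadditivity would make \<open>T N \<inter> D\<close> null. So a half that
  succeeds for all \<open>N\<close> at once can be chosen at every stage.\<close>

lemma positive_density_branch: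
  fixes T B :: "nat \<Rightarrow> int set"
  assumes "decseq T" and "\<And>N. BD (T N) > 0"
  shows "\<exists>J. \<forall>n N. BD (T N \<inter> {t. \<forall>j<n. t \<in> B j \<longleftrightarrow> j \<in> J}) > 0"
proof -
  have step: "(\<forall>N. BD (T N \<inter> (D \<inter> B n)) > 0) \<or> (\<forall>N. BD (T N \<inter> (D - B n)) > 0)"
    if D: "\<forall>N. BD (T N \<inter> D) > 0" for D n
  proof (rule ccontr)
    assume "\<not> ?thesis"
    then obtain N1 N2 where
      N: "BD (T N1 \<inter> (D \<inter> B n)) \<le> 0" "BD (T N2 \<inter> (D - B n)) \<le> 0"
      unfolding de_Morgan_disj not_all not_less by (elim conjE exE)
    let ?N = "max N1 N2"
    have "T ?N \<subseteq> T N1" "T ?N \<subseteq> T N2"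
      using assms(1) by (auto simp: decseq_def)
    then have "BD (T ?N \<inter> (D \<inter> B n)) \<le> BD (T N1 \<inter> (D \<inter> B n))"
        "BD (T ?N \<inter> (D - B n)) \<le> BD (T N2 \<inter> (D - B n))"
      by (auto intro!: BD_mono)
    with N have "BD (T ?N \<inter> (D \<inter> B n)) \<le> 0" "BD (T ?N \<inter> (D - B n)) \<le> 0"
      by linarith+
    moreover have "T ?N \<inter> D = (T ?N \<inter> (D \<inter> B n)) \<union> (T ?N \<inter> (D - B n))" by auto
    ultimately have "BD (T ?N \<inter> D) \<le> 0"
      using BD_Un_le[of "T ?N \<inter> (D \<inter> B n)" "T ?N \<inter> (D - B n)"] by simp
    with spec[OF D, of ?N] show False by linarith
  qed
  have "\<exists>D. \<forall>n. (\<forall>N. BD (T N \<inter> D n) > 0) \<and> (D (Suc n) = D n \<inter> B n \<or> D (Suc n) = D n - B n)"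
  proof (rule dependent_nat_choice)
    show "\<exists>D. \<forall>N. BD (T N \<inter> D) > 0"
      using assms(2) by (intro exI[of _ UNIV]) simp
    fix D n assume "\<forall>N. BD (T N \<inter> D) > 0"
    from step[OF this, of n]
    show "\<exists>D'. (\<forall>N. BD (T N \<inter> D') > 0) \<and> (D' = D \<inter> B n \<or> D' = D - B n)"
      by (elim disjE) (rule exI, rule conjI, assumption, simp)+
  qed
  then obtain D where "\<forall>n. (\<forall>N. BD (T N \<inter> D n) > 0)
      \<and> (D (Suc n) = D n \<inter> B n \<or> D (Suc n) = D n - B n)" ..
  then have D: "BD (T N \<inter> D n) > 0" "D (Suc n) = D n \<inter> B n \<or> D (Suc n) = D n - B n" for n N
    by iprover+
  define J where "J = {n. D (Suc n) = D n \<inter> B n}"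
  have sub: "D n \<subseteq> {t. \<forall>j<n. t \<in> B j \<longleftrightarrow> j \<in> J}" for n
  proof (induction n)
    case (Suc n)
    have "D (Suc n) \<subseteq> D n" using D(2)[of n] by blast
    moreover have "t \<in> B n \<longleftrightarrow> n \<in> J" if "t \<in> D (Suc n)" for t
      using D(2)[of n] that unfolding J_def by auto
    ultimately show ?case using Suc by (auto simp: less_Suc_eq)
  qed simp
  have "BD (T N \<inter> {t. \<forall>j<n. t \<in> B j \<longleftrightarrow> j \<in> J}) > 0" for n N
  proof -
    have "BD (T N \<inter> D n) \<le> BD (T N \<inter> {t. \<forall>j<n. t \<in> B j \<longleftrightarrow> j \<in> J})"
      using sub[of n] by (intro BD_mono) auto
    with D(1)[of N n] show ?thesis by linarith
  qed
  then show ?thesis by blast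
qed

section \<open>Embedding a set of large Schnirelmann density\<close>

theorem mainTheorem2:
  fixes A :: "int set" and \<alpha> :: real
  assumes "BD A = \<alpha>" and "\<alpha> > 0"
  shows "\<exists>E::int set. E \<subseteq> {1..} \<and>
    schnirelmann_density E \<ge> \<alpha> \<and>
    E \<lhd>\<^sub>d A \<and>
    Delta E \<subseteq> Delta_eps 0 A \<and>
    (\<forall>\<epsilon>\<ge>0. Delta_eps \<epsilon> E \<subseteq> Delta_eps \<epsilon> A)"
proof -
  \<comment> \<open>Any nonnegative densities strictly below \<open>\<alpha>\<close> that increase to \<open>\<alpha>\<close> would do.\<close>
  define c where "c N = \<alpha> * (1 + - inverse (real (Suc N)))" for N
  define T where "T N = dense_starts A (c N) N" for N
  have c_lim: "c \<longlonglongrightarrow> \<alpha>"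
    unfolding c_def by (rule LIMSEQ_inverse_real_of_nat_add_minus_mult)
  have c_bounds: "0 \<le> c N" "c N < \<alpha>" for N
    using assms(2) by (auto simp: c_def field_simps)
  have c_mono: "c M \<le> c N" if "M \<le> N" for M N
    using assms(2) that by (auto simp: c_def intro!: mult_left_mono le_imp_inverse_le)
  have "decseq T"
  proof (rule decseq_SucI, rule subsetI)
    fix N t assume t: "t \<in> T (Suc N)"
    have "c N * real m \<le> real (card (A \<inter> {t + 1..t + int m}))" if "m \<in> {1..N}" for m
    proof -
      have "c N * real m \<le> c (Suc N) * real m"
        using c_mono[of N "Suc N"] by (intro mult_right_mono) auto
      also have "\<dots> \<le> real (card (A \<inter> {t + 1..t + int m}))"
        using t that by (auto simp: T_def dense_starts_def)
      finally show ?thesis .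
    qed
    then show "t \<in> T N" by (simp add: T_def dense_starts_def)
  qed
  moreover have "BD (T N) > 0" for N
    using BD_le_dense_starts[OF c_bounds(1), of A N N] c_bounds(2)[of N] assms(1)
    unfolding T_def by linarith
  ultimately obtain J where
    J: "\<And>n N. BD (T N \<inter> {t. \<forall>j<n. t \<in> shift A (int (Suc j)) \<longleftrightarrow> j \<in> J}) > 0"
    using positive_density_branch[of T "\<lambda>j. shift A (int (Suc j))"] by blast
  define E where "E = (\<lambda>j. int (Suc j)) ` J"
  have E_pos: "E \<subseteq> {1..}" by (auto simp: E_def)
  have E_iff: "int (Suc j) \<in> E \<longleftrightarrow> j \<in> J" for j by (auto simp: E_def)
  define P where "P n = {t. \<forall>i\<in>{1..int n}. t + i \<in> A \<longleftrightarrow> i \<in> E}" for n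
  have P_alt: "{t. \<forall>j<n. t \<in> shift A (int (Suc j)) \<longleftrightarrow> j \<in> J} \<subseteq> P n" for n
  proof
    fix t assume t: "t \<in> {t. \<forall>j<n. t \<in> shift A (int (Suc j)) \<longleftrightarrow> j \<in> J}"
    have "t + i \<in> A \<longleftrightarrow> i \<in> E" if "i \<in> {1..int n}" for i
    proof -
      have "i = int (Suc (nat (i - 1)))" "nat (i - 1) < n" using that by auto
      then obtain j where "i = int (Suc j)" "j < n" by blast
      with t E_iff[of j] show ?thesis by (simp add: add.commute del: of_nat_Suc)
    qed
    then show "t \<in> P n" by (simp add: P_def)
  qed
  have P: "BD (T N \<inter> P n) > 0" for n N
    using J[of N n] BD_mono[OF Int_mono[OF order_refl P_alt[of n]], of "T N"] by linarith

  have "\<alpha> \<le> real (card (E \<inter> {1..int n})) / real n" if n: "n \<ge> 1" for n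
  proof (rule LIMSEQ_le_const2[OF c_lim], intro exI allI impI)
    fix N assume N: "n \<le> N"
    have "T N \<inter> P n \<noteq> {}" using P[of N n] by force
    then obtain t where t: "t \<in> T N" "t \<in> P n" by blast
    have "A \<inter> {t + 1..t + int n} = (\<lambda>i. t + i) ` (E \<inter> {1..int n})"
    proof (intro set_eqI iffI)
      fix y assume "y \<in> A \<inter> {t + 1..t + int n}"
      with t(2) have "y - t \<in> E \<inter> {1..int n}" "y = t + (y - t)"
        by (auto simp: P_def dest!: bspec[of _ _ "y - t"])
      then show "y \<in> (\<lambda>i. t + i) ` (E \<inter> {1..int n})" by blast
    qed (use t(2) in \<open>auto simp: P_def\<close>)
    then have "card (A \<inter> {t + 1..t + int n}) = card (E \<inter> {1..int n})"
      by (simp add: card_image)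
    moreover have "c N * real n \<le> real (card (A \<inter> {t + 1..t + int n}))"
      using t(1) n N by (auto simp: T_def dense_starts_def)
    ultimately show "c N \<le> real (card (E \<inter> {1..int n})) / real n"
      using n by (simp add: field_simps)
  qed
  then have density: "schnirelmann_density E \<ge> \<alpha>"
    unfolding schnirelmann_density_def by (intro cINF_greatest) auto

  have embed: "E \<lhd>\<^sub>d A"
    unfolding densely_embeddable_def
  proof (intro allI impI)
    fix F assume F: "finite F \<and> F \<subseteq> E"
    define n where "n = nat (Max (insert 0 F))"
    have "F \<subseteq> {1..int n}"
    proof
      fix i assume i: "i \<in> F"
      then have "i \<le> Max (insert 0 F)" using F by simp
      with i F E_pos show "i \<in> {1..int n}" by (auto simp: n_def)
    qed
    with F have "T 0 \<inter> P n \<subseteq> (\<Inter>x\<in>F. shift A x)" by (auto simp: P_def)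
    then show "BD (\<Inter>x\<in>F. shift A x) > 0"
      using P[of 0 n] BD_mono by (meson less_le_trans)
  qed
  show ?thesis
    using E_pos density embed densely_embeddable_Delta[OF embed]
      densely_embeddable_Delta_eps[OF embed] by blast
qed

end
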